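(* There exists at least one value of $r$ for which there is an intersecting $r$-partite hypergraph $H$ such that each of its sides has exactly $r$ vertices and, for every line $e\in H$ and every vertex $v\in e$, the set $e\setminus\{v\}$ is not a cover of $H$.
   Context: A hypergraph $H$ is a set of non-empty subsets (lines) of a finite vertex set $V(H)$, every vertex lying on at least one line. $H$ is $r$-partite if $V(H)$ is partitioned into $r$ sets (sides) such that every line contains exactly one vertex from each side. A cover is a set of vertices meeting every line. $H$ is intersecting if every two lines share at least one vertex. *)

theory Defs
  imports Main "HOL-Library.Disjoint_Sets"
begin

definition hypergraph :: "'a set \<Rightarrow> 'a set set \<Rightarrow> bool" where
  "hypergraph V H \<longleftrightarrow>
     finite V \<and> (\<forall>e\<in>H. e \<noteq> {} \<and> e \<subseteq> V) \<and> (\<forall>v\<in>V. \<exists>e\<in>H. v \<in> e)"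

text \<open>The sides are the members of \<open>P\<close>; \<^const>\<open>partition_on\<close> makes them non-empty, and
  \<open>card P = r\<close> counts them correctly because \<open>P\<close> is finite when \<open>V\<close> is.\<close>

definition partite_with_sides :: "nat \<Rightarrow> 'a set \<Rightarrow> 'a set set \<Rightarrow> 'a set set \<Rightarrow> bool" where
  "partite_with_sides r V H P \<longleftrightarrow>
     partition_on V P \<and> card P = r \<and> (\<forall>e\<in>H. \<forall>S\<in>P. \<exists>!v. v \<in> e \<inter> S)"

definition is_cover :: "'a set \<Rightarrow> 'a set set \<Rightarrow> 'a set \<Rightarrow> bool" where
  "is_cover V H C \<longleftrightarrow> C \<subseteq> V \<and> (\<forall>e\<in>H. C \<inter> e \<noteq> {})"

definition intersecting :: "'a set set \<Rightarrow> bool" where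
  "intersecting H \<longleftrightarrow> (\<forall>e\<in>H. \<forall>f\<in>H. e \<inter> f \<noteq> {})"

end

theory Submission
  imports Defs "HOL-Number_Theory.Cong"
begin

text \<open>
  If every two lines meet in exactly one vertex and every vertex lies on at least two lines, then
  \<open>e - {v}\<close> misses every line other than \<open>e\<close> through \<open>v\<close>. Dually, such a hypergraph with \<open>r\<close> sides
  of size \<open>r\<close> consists of \<open>r\<close> partitions of the set of lines, each into \<open>r\<close> classes of at least two
  lines, such that every two lines share a class in exactly one of the partitions. For \<open>r = 13\<close> and
  \<open>39\<close> lines indexed by \<open>\<int>/13 \<times> {0, 1, 2}\<close>, the partitions can be taken to be the \<open>13\<close> translates of
  one partition. What is needed then is that the differences within its classes represent every
  nonzero difference within each copy of \<open>\<int>/13\<close>, and every difference between two distinct copies,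
  exactly once. A partition invariant under \<open>(x, i) \<mapsto> (3 x, i + 1)\<close> with class sizes
  \<open>3, 6, 6, 6, 2, \<dots>, 2\<close> was found by computer search.
\<close>

text \<open>Line \<open>p\<close> is encoded by a word whose letter \<open>w p k\<close> is its
  vertex on side \<open>k\<close>; the number \<open>r * k + s\<close> codes vertex \<open>s\<close>
  of side \<open>k\<close>. Existence in \<open>linear\<close> makes lines intersect; uniqueness and
  \<open>degree\<close> prevent \<open>e - {v}\<close> from being a cover.\<close>

lemma noncover_hypergraph_of_words:
  fixes w :: "'i \<Rightarrow> nat \<Rightarrow> nat"
  assumes r: "r > 0"
    and range: "\<And>p k. p \<in> I \<Longrightarrow> k < r \<Longrightarrow> w p k < r"
    and degree: "\<And>k s. k < r \<Longrightarrow> s < r \<Longrightarrow> \<exists>p\<in>I. \<exists>q\<in>I. p \<noteq> q \<and> w p k = s \<and> w q k = s"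
    and linear: "\<And>p q. p \<in> I \<Longrightarrow> q \<in> I \<Longrightarrow> p \<noteq> q \<Longrightarrow> \<exists>!k. k < r \<and> w p k = w q k"
  shows "\<exists>(V :: nat set) H P.
           hypergraph V H \<and> partite_with_sides r V H P \<and> intersecting H \<and>
           (\<forall>S\<in>P. card S = r) \<and>
           (\<forall>e\<in>H. \<forall>v\<in>e. \<not> is_cover V H (e - {v}))"
proof -
  define line where "line p = {v. v < r * r \<and> w p (v div r) = v mod r}" for p
  define side where "side k = {v. v < r * r \<and> v div r = k}" for k
  define V where "V = {..<r * r}"
  define H where "H = line ` I"
  define P where "P = side ` {..<r}"
  have div_less: "v div r < r" if "v < r * r" for v
    using that by (simp add: less_mult_imp_div_less)
  have vertex_less: "r * k + s < r * r" if "k < r" "s < r" for k s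
  proof -
    have "r * k + s < r * Suc k" using that by simp
    also have "\<dots> \<le> r * r" using that by (intro mult_le_mono) auto
    finally show ?thesis .
  qed
  have vertex_line: "r * k + w p k \<in> line p" if "p \<in> I" "k < r" for p k
    using that range[OF that] vertex_less[OF that(2) range[OF that]] by (simp add: line_def)
  have side_eq: "side k = (\<lambda>s. r * k + s) ` {..<r}" if "k < r" for k
  proof (intro set_eqI iffI)
    fix v assume "v \<in> side k"
    then have "v = r * k + v mod r" "v mod r < r" using r by (auto simp: side_def)
    then show "v \<in> (\<lambda>s. r * k + s) ` {..<r}" by blast
  qed (use that vertex_less in \<open>auto simp: side_def\<close>)
  have card_side: "card (side k) = r" if "k < r" for k
    unfolding side_eq[OF that] by (subst card_image) (auto simp: inj_on_def)
  have side_nonempty: "side k \<noteq> {}" if "k < r" for k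
    using card_side[OF that] r by auto

  have "hypergraph V H"
    unfolding hypergraph_def
  proof (intro conjI ballI)
    fix v assume "v \<in> V"
    then have v: "v < r * r" by (simp add: V_def)
    then obtain p where "p \<in> I" "w p (v div r) = v mod r"
      using degree[OF div_less[OF v], of "v mod r"] r by auto
    then show "\<exists>e\<in>H. v \<in> e" using v by (auto simp: H_def line_def)
  next
    fix e assume "e \<in> H"
    then show "e \<noteq> {}" using vertex_line r by (auto simp: H_def)
  qed (auto simp: V_def H_def line_def)
  moreover have "partite_with_sides r V H P"
    unfolding partite_with_sides_def
  proof (intro conjI ballI)
    show "partition_on V P"
    proof (rule partition_onI)
      show "\<Union>P = V" using div_less by (auto simp: P_def V_def side_def)
      show "{} \<notin> P" using side_nonempty by (auto simp: P_def)
      show "\<And>S T. S \<in> P \<Longrightarrow> T \<in> P \<Longrightarrow> S \<noteq> T \<Longrightarrow> disjnt S T"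
        by (auto simp: P_def side_def disjnt_def)
    qed
    have "inj_on side {..<r}"
    proof (rule inj_onI)
      fix k l assume "k \<in> {..<r}" "side k = side l"
      then obtain v where "v \<in> side k" "v \<in> side l" using side_nonempty by blast
      then show "k = l" by (simp add: side_def)
    qed
    then show "card P = r" by (simp add: P_def card_image)
    fix e S assume "e \<in> H" "S \<in> P"
    then obtain p k where pk: "p \<in> I" "e = line p" "k < r" "S = side k"
      by (auto simp: H_def P_def)
    show "\<exists>!v. v \<in> e \<inter> S"
    proof (rule ex1I)
      show "r * k + w p k \<in> e \<inter> S"
        using pk range vertex_line by (auto simp: side_eq)
      fix v assume "v \<in> e \<inter> S"
      then have "v div r = k" "v mod r = w p k" using pk by (auto simp: line_def side_def)
      then show "v = r * k + w p k" by (metis mult_div_mod_eq)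
    qed
  qed
  moreover have "intersecting H"
    unfolding intersecting_def
  proof (intro ballI)
    fix e f assume "e \<in> H" "f \<in> H"
    then obtain p q where pq: "p \<in> I" "q \<in> I" "e = line p" "f = line q" by (auto simp: H_def)
    \<comment> \<open>If \<open>p = q\<close>, any side will do, and one exists since
      \<open>r > 0\<close>.\<close>
    obtain k where "k < r" "w p k = w q k"
      using linear[OF pq(1,2)] r by (cases "p = q") auto
    then show "e \<inter> f \<noteq> {}" using pq vertex_line by (metis disjoint_iff)
  qed
  moreover have "\<forall>S\<in>P. card S = r" using card_side by (auto simp: P_def)
  moreover have "\<not> is_cover V H (e - {v})" if ev: "e \<in> H" "v \<in> e" for e v
  proof -
    obtain p where p: "p \<in> I" "e = line p" using ev by (auto simp: H_def)
    define k where "k = v div r"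
    have k: "k < r" "w p k = v mod r"
      using ev p div_less by (auto simp: line_def k_def)
    \<comment> \<open>Of the two indices that \<open>degree\<close> gives for the vertex
      \<open>v\<close>, at least one differs from \<open>p\<close>.\<close>
    obtain q where q: "q \<in> I" "p \<noteq> q" "w q k = w p k"
      using degree[OF k(1), of "w p k"] range[OF p(1) k(1)] by metis
    \<comment> \<open>On the side of a common vertex the two words agree, so by uniqueness in
      \<open>linear\<close> that side is \<open>k\<close>.\<close>
    have "u = v" if "u \<in> line p" "u \<in> line q" for u
    proof -
      have "u div r < r" "w p (u div r) = w q (u div r)" "u mod r = w p (u div r)"
        using that div_less by (auto simp: line_def)
      with linear[OF p(1) q(1,2)] k(1) q(3) have "u div r = v div r" "u mod r = v mod r"
        using k k_def by metis+
      then show "u = v" by (metis mult_div_mod_eq)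
    qed
    then have "(e - {v}) \<inter> line q = {}" using p by auto
    then show ?thesis using q by (auto simp: is_cover_def H_def)
  qed
  ultimately show ?thesis by blast
qed

lemma bij_betw_add_mod:
  fixes r :: nat
  assumes "r > 0"
  shows "bij_betw (\<lambda>k. (x + k) mod r) {..<r} {..<r}"
proof -
  have "inj_on (\<lambda>k. (x + k) mod r) {..<r}"
  proof (rule inj_onI)
    fix k l assume "k \<in> {..<r}" "l \<in> {..<r}" "(x + k) mod r = (x + l) mod r"
    then have "[x + k = x + l] (mod r)" by (simp add: cong_def)
    then have "[k = l] (mod r)" by (simp add: cong_add_lcancel_nat)
    with \<open>k \<in> {..<r}\<close> \<open>l \<in> {..<r}\<close> show "k = l" by (simp add: cong_def)
  qed
  moreover have "(\<lambda>k. (x + k) mod r) ` {..<r} \<subseteq> {..<r}" using assms by auto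
  ultimately show ?thesis by (simp add: bij_betw_def endo_inj_surj)
qed

text \<open>Entry \<open>x\<close> of row \<open>i\<close> is the number of the class of \<open>(x, i)\<close> in the base partition.\<close>

definition class_table :: "nat list list" where
  "class_table =
    [[0, 1, 1, 3, 2, 4, 1, 7, 9, 10, 5, 12, 1],
     [0, 11, 5, 2, 6, 2, 2, 10, 8, 1, 2, 7, 3],
     [0, 2, 3, 12, 3, 3, 6, 8, 11, 3, 1, 9, 4]]"

lemma class_table_less: "i < 3 \<Longrightarrow> z < 13 \<Longrightarrow> class_table ! i ! z < 13"
proof -
  have "\<forall>i\<in>set [0..<3]. \<forall>z\<in>set [0..<13]. class_table ! i ! z < 13"
    by (simp add: class_table_def upt_conv_Cons)
  then show "i < 3 \<Longrightarrow> z < 13 \<Longrightarrow> class_table ! i ! z < 13" by simp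
qed

lemma class_table_two:
  assumes "s < 13"
  shows "\<exists>a<13. \<exists>b<13. \<exists>i<3. \<exists>j<3. (a, i) \<noteq> (b, j) \<and>
           class_table ! i ! a = s \<and> class_table ! j ! b = s"
proof -
  \<comment> \<open>Phrased with lists so that simplification can evaluate it; distinctness of the
    list then turns length into cardinality.\<close>
  have *: "\<forall>s\<in>set [0..<13].
      2 \<le> length (filter (\<lambda>(a, i). class_table ! i ! a = s) (List.product [0..<13] [0..<3]))"
    by (simp add: class_table_def upt_conv_Cons)
  let ?L = "filter (\<lambda>(a, i). class_table ! i ! a = s) (List.product [0..<13] [0..<3])"
  have "2 \<le> card (set ?L)"
    using assms * by (subst distinct_card) (auto intro!: distinct_filter distinct_product)
  then obtain p q where "p \<in> set ?L" "q \<in> set ?L" "p \<noteq> q"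
    by (meson card_2_iff' obtain_subset_with_card_n subsetD)
  moreover obtain a i b j where "p = (a, i)" "q = (b, j)" by (metis surj_pair)
  ultimately have "a < 13" "b < 13" "i < 3" "j < 3" "(a, i) \<noteq> (b, j)"
    "class_table ! i ! a = s" "class_table ! j ! b = s"
    by simp_all
  then show ?thesis by blast
qed

text \<open>A finite check of 114 triples \<open>(i, j, d)\<close>. The count is tight: class sizes
  3, 6, 6, 6 and nine times 2 give 6 + 90 + 18 = 114 ordered pairs of distinct elements in a common
  class.\<close>

lemma class_table_difference:
  assumes "i < 3" "j < 3" "d < 13" "d \<noteq> 0 \<or> i \<noteq> j"
  shows "\<exists>!z. z < 13 \<and> class_table ! i ! z = class_table ! j ! ((z + d) mod 13)"
proof -
  have *: "\<forall>i\<in>set [0..<3]. \<forall>j\<in>set [0..<3]. \<forall>d\<in>set [0..<13]. d = 0 \<and> i = j \<or>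
      length (filter (\<lambda>z. class_table ! i ! z = class_table ! j ! ((z + d) mod 13)) [0..<13]) = 1"
    by (simp add: class_table_def upt_conv_Cons)
  let ?L = "filter (\<lambda>z. class_table ! i ! z = class_table ! j ! ((z + d) mod 13)) [0..<13]"
  have "length ?L = 1" using *[rule_format, of i j d] assms by auto
  then obtain z where "?L = [z]" by (auto simp: length_Suc_conv)
  then have "set ?L = {z}" by (metis list.set(1,2))
  then show ?thesis by (auto simp: set_eq_iff)
qed

text \<open>Side \<open>k\<close> is the base partition translated by \<open>-k\<close>, and the
  letter is the class of \<open>p\<close> in it.\<close>

definition line_word :: "nat \<times> nat \<Rightarrow> nat \<Rightarrow> nat" where
  "line_word p k = class_table ! snd p ! ((fst p + k) mod 13)"

text \<open>As \<open>k\<close> runs over the residues, \<open>z = x + k\<close> takes each residue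
  once while \<open>y + k\<close> stays at the fixed difference \<open>d\<close> from it, so the
  unique \<open>z\<close> for \<open>d\<close> yields a unique \<open>k\<close>.\<close>

lemma line_word_linear:
  assumes "x < 13" "y < 13" "i < 3" "j < 3" "(x, i) \<noteq> (y, j)"
  shows "\<exists>!k. k < 13 \<and> line_word (x, i) k = line_word (y, j) k"
proof -
  \<comment> \<open>This is \<open>y - x\<close> modulo 13; adding \<open>13 - x\<close> avoids
    truncated subtraction.\<close>
  define d where "d = (y + (13 - x)) mod 13"
  have shift: "(y + k) mod 13 = ((x + k) mod 13 + d) mod 13" for k
  proof -
    have "((x + k) mod 13 + d) mod 13 = (x + k + (y + (13 - x))) mod 13"
      by (simp only: d_def mod_add_eq)
    also have "x + k + (y + (13 - x)) = y + k + 13" using assms by simp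
    finally show ?thesis by simp
  qed
  have "d \<noteq> 0 \<or> i \<noteq> j"
  proof (rule ccontr)
    assume "\<not> (d \<noteq> 0 \<or> i \<noteq> j)"
    then have "d = 0" "i = j" by auto
    then have "y = x" using shift[of 0] assms by simp
    with \<open>i = j\<close> assms show False by simp
  qed
  moreover have "d < 13" by (simp add: d_def)
  ultimately have ex1: "\<exists>!z. z < 13 \<and> class_table ! i ! z = class_table ! j ! ((z + d) mod 13)"
    using assms by (intro class_table_difference)
  then obtain z where z: "z < 13" "class_table ! i ! z = class_table ! j ! ((z + d) mod 13)"
    by blast
  have bij: "bij_betw (\<lambda>k. (x + k) mod 13) {..<13} {..<13}"
    by (rule bij_betw_add_mod) simp
  have "z \<in> (\<lambda>k. (x + k) mod 13) ` {..<13}"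
    unfolding bij_betw_imp_surj_on[OF bij] using z(1) by simp
  then obtain k where k: "k < 13" "(x + k) mod 13 = z" by blast
  have word: "line_word (x, i) l = class_table ! i ! ((x + l) mod 13)"
    "line_word (y, j) l = class_table ! j ! (((x + l) mod 13 + d) mod 13)" for l
    by (simp_all only: line_word_def fst_conv snd_conv shift)
  show ?thesis
  proof (rule ex1I)
    show "k < 13 \<and> line_word (x, i) k = line_word (y, j) k"
      unfolding word using k z by simp
    fix l assume l: "l < 13 \<and> line_word (x, i) l = line_word (y, j) l"
    then have "(x + l) mod 13 < 13 \<and>
        class_table ! i ! ((x + l) mod 13) = class_table ! j ! (((x + l) mod 13 + d) mod 13)"
      unfolding word by simp
    with ex1 z have "(x + l) mod 13 = z" by blast
    then have "(x + l) mod 13 = (x + k) mod 13" using k(2) by (rule trans[OF _ sym])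
    moreover have "l \<in> {..<13}" "k \<in> {..<13}" using k(1) l by auto
    ultimately show "l = k" by (rule inj_onD[OF bij_betw_imp_inj_on[OF bij], of l k])
  qed
qed

text \<open>Translation by \<open>k\<close> permutes each row, so every class keeps its at least two
  elements.\<close>

lemma line_word_degree:
  assumes "k < 13" "s < 13"
  shows "\<exists>p\<in>{..<13} \<times> {..<3}. \<exists>q\<in>{..<13} \<times> {..<3}.
           p \<noteq> q \<and> line_word p k = s \<and> line_word q k = s"
proof -
  have surj: "\<exists>x<13. (x + k) mod 13 = a" if "a < 13" for a
  proof -
    have "(\<lambda>x. (k + x) mod 13) ` {..<13} = {..<13}"
      using bij_betw_add_mod[of 13 k] by (simp add: bij_betw_def)
    then have "a \<in> (\<lambda>x. (k + x) mod 13) ` {..<13}" using that by simp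
    then show ?thesis by (auto simp: add.commute)
  qed
  obtain a b i j where ab: "a < 13" "b < 13" "i < 3" "j < 3" "(a, i) \<noteq> (b, j)"
    "class_table ! i ! a = s" "class_table ! j ! b = s"
    using class_table_two[OF assms(2)] by blast
  obtain x y where "x < 13" "(x + k) mod 13 = a" "y < 13" "(y + k) mod 13 = b"
    using surj ab by metis
  with ab show ?thesis
    by (intro bexI[of _ "(x, i)"] bexI[of _ "(y, j)"]) (auto simp: line_word_def)
qed

theorem theorem3p1:
  shows "\<exists>r\<ge>2. \<exists>(V :: nat set) (H :: nat set set) (P :: nat set set).
           hypergraph V H \<and> partite_with_sides r V H P \<and> intersecting H \<and>
           (\<forall>S\<in>P. card S = r) \<and>
           (\<forall>e\<in>H. \<forall>v\<in>e. \<not> is_cover V H (e - {v}))"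
proof (rule exI[of _ 13], rule conjI)
  show "(2 :: nat) \<le> 13" by simp
  show "\<exists>(V :: nat set) (H :: nat set set) (P :: nat set set).
           hypergraph V H \<and> partite_with_sides 13 V H P \<and> intersecting H \<and>
           (\<forall>S\<in>P. card S = 13) \<and>
           (\<forall>e\<in>H. \<forall>v\<in>e. \<not> is_cover V H (e - {v}))"
  \<comment> \<open>The number 13 serves twice: the 13 translates are the sides, and the 13 classes
    of each are the vertices of that side.\<close>
  proof (rule noncover_hypergraph_of_words[where w = line_word and I = "{..<13} \<times> {..<3}"])
    fix p :: "nat \<times> nat" and k :: nat
    assume "p \<in> {..<13} \<times> {..<3}" "k < 13"
    then show "line_word p k < 13"
      by (auto simp: line_word_def class_table_less)
  next
    fix p q :: "nat \<times> nat"
    assume "p \<in> {..<13} \<times> {..<3}" "q \<in> {..<13} \<times> {..<3}" "p \<noteq> q"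
    then show "\<exists>!k. k < 13 \<and> line_word p k = line_word q k"
      using line_word_linear[of "fst p" "fst q" "snd p" "snd q"] by (simp add: mem_Times_iff)
  qed (simp, rule line_word_degree)
qed

end
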